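(* Let $\mathbf{h}=(h_j)_{j\ge 0}$ be an eventually increasing sequence of nonnegative integers, and for each integer $n\ge 0$ let $H_n^{\mathbf h}(z)=\sum_{j=0}^{n}\binom{n}{j}z^{h_j}$. Then for all integers $r,n\ge 0$ we have $$\sum_{k=0}^{r}(-1)^{k}\binom{r}{k}H^{\mathbf h}_{n+r-k}(z)=\sum_{k=0}^{n}\binom{n}{k}z^{h_{k+r}}$$ (as an identity of polynomials in $z$). In particular, for every real $z>0$ the sequence $(H^{\mathbf h}_{n}(z))_{n\ge 0}$ is absolutely monotonic.
   Context: A sequence $(h_j)_{j\ge0}$ is eventually increasing if there is $J$ with $h_j<h_{j+1}$ for all $j\ge J$. A sequence $(a_n)_{n\ge 0}$ of real numbers is called absolutely monotonic if $\Delta^r a_n\ge 0$ for all integers $r,n\ge 0$, where $\Delta^0a_n=a_n$, $\Delta a_n=a_{n+1}-a_n$ and $\Delta^{r+1}=\Delta\circ\Delta^r$. *)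

theory Defs
  imports Complex_Main "HOL-Computational_Algebra.Polynomial"
begin

definition eventually_increasing :: "(nat \<Rightarrow> nat) \<Rightarrow> bool" where
  "eventually_increasing h \<longleftrightarrow> (\<exists>J. \<forall>j\<ge>J. h j < h (j + 1))"

definition fwd_diff :: "(nat \<Rightarrow> real) \<Rightarrow> nat \<Rightarrow> real" where
  "fwd_diff a n = a (n + 1) - a n"

definition absolutely_monotonic :: "(nat \<Rightarrow> real) \<Rightarrow> bool" where
  "absolutely_monotonic a \<longleftrightarrow> (\<forall>r n. (fwd_diff ^^ r) a n \<ge> 0)"

definition H_poly :: "(nat \<Rightarrow> nat) \<Rightarrow> nat \<Rightarrow> real poly" where
  "H_poly h n = (\<Sum>j=0..n. smult (real (n choose j)) (monom 1 (h j)))"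

end

theory Submission
  imports Defs
begin

text \<open>With E the shift of sequences, the binomial transform of f at n is the value at 0 of (1
  + E)^n f. Differencing in n multiplies by (1 + E) - 1 = E, so the r-th difference is the transform
  of the shifted sequence. Now \<open>H_poly h\<close> is the transform of the monomials z^(h j),
  and the alternating sum is the expanded r-th difference:
  \<open>alternating_sum_binomial_transform\<close> gives the identity. For z > 0,
  \<open>fwd_diff_funpow_binomial_transform\<close> writes every difference as a nonnegative
  combination of powers of z. Working over any commutative ring covers both polynomials and their
  values.\<close>

definition binomial_transform :: "(nat \<Rightarrow> 'a::comm_ring_1) \<Rightarrow> nat \<Rightarrow> 'a" where
  "binomial_transform f n = (\<Sum>k\<le>n. of_nat (n choose k) * f k)"

text \<open>Pascal's rule: on binomial transforms, the forward difference acts as a shift of \<open>f\<close>.\<close>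

lemma binomial_transform_Suc:
  "binomial_transform f (Suc n) =
     binomial_transform f n + binomial_transform (\<lambda>k. f (Suc k)) n"
proof -
  have "binomial_transform f (Suc n) =
      f 0 + (\<Sum>k\<le>n. of_nat (Suc n choose Suc k) * f (Suc k))"
    unfolding binomial_transform_def by (subst sum.atMost_Suc_shift) simp
  also have "\<dots> = (f 0 + (\<Sum>k\<le>n. of_nat (n choose Suc k) * f (Suc k)))
      + binomial_transform (\<lambda>k. f (Suc k)) n"
    by (simp add: binomial_transform_def sum.distrib algebra_simps)
  \<comment> \<open>Reindexing overshoots to \<open>Suc n\<close>, harmlessly:
    \<open>n choose Suc n\<close> is 0.\<close>
  also have "f 0 + (\<Sum>k\<le>n. of_nat (n choose Suc k) * f (Suc k)) =
      (\<Sum>k\<le>Suc n. of_nat (n choose k) * f k)"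
    by (subst sum.atMost_Suc_shift) simp
  also have "\<dots> = binomial_transform f n"
    by (simp add: binomial_transform_def binomial_eq_0)
  finally show ?thesis .
qed

lemma binomial_transform_add:
  "binomial_transform (\<lambda>k. f k + g k) n = binomial_transform f n + binomial_transform g n"
  by (simp add: binomial_transform_def sum.distrib distrib_left)

text \<open>The alternating sum is itself a binomial transform in \<open>r\<close>, so Pascal's rule applies both
  to the outer sum and to the inner transform.\<close>

lemma alternating_sum_binomial_transform:
  "(\<Sum>k\<le>r. (-1) ^ k * of_nat (r choose k) * binomial_transform f (n + r - k)) =
     binomial_transform (\<lambda>k. f (k + r)) n"
proof -
  have "binomial_transform (\<lambda>k. (-1) ^ k * binomial_transform f (n + r - k)) r =
      binomial_transform (\<lambda>k. f (k + r)) n"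
  \<comment> \<open>The induction step passes to the shifted sequence, so \<open>f\<close> must
    vary.\<close>
  proof (induction r arbitrary: f)
    case 0
    show ?case by (simp add: binomial_transform_def[of _ 0])
  next
    case (Suc r)
    \<comment> \<open>Pascal's rule in \<open>r\<close>; the shift of \<open>k\<close> flips the
      sign and turns the sum into a difference.\<close>
    have "binomial_transform (\<lambda>k. (-1) ^ k * binomial_transform f (n + Suc r - k)) (Suc r) =
        binomial_transform (\<lambda>k. (-1) ^ k * (binomial_transform f (n + Suc r - k)
          - binomial_transform f (n + r - k))) r"
      by (simp add: binomial_transform_Suc[of _ r] binomial_transform_add[symmetric]
          algebra_simps)
    \<comment> \<open>Pascal's rule in the inner index. Only k \<le> r occurs, so the truncated
      subtraction is exact.\<close>
    also have "\<dots> = binomial_transform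
        (\<lambda>k. (-1) ^ k * binomial_transform (\<lambda>i. f (Suc i)) (n + r - k)) r"
      unfolding binomial_transform_def[of _ r]
      by (intro sum.cong refl) (simp add: Suc_diff_le binomial_transform_Suc)
    also have "\<dots> = binomial_transform (\<lambda>k. f (k + Suc r)) n"
      by (simp add: Suc.IH)
    finally show ?case .
  qed
  then show ?thesis
    by (simp add: binomial_transform_def[of _ r] mult_ac)
qed

lemma fwd_diff_funpow_binomial_transform:
  "(fwd_diff ^^ r) (binomial_transform f) = binomial_transform (\<lambda>k. f (k + r))"
proof (induction r)
  case (Suc r)
  then show ?case
    by (simp add: fwd_diff_def binomial_transform_Suc fun_eq_iff)
qed simp

lemma absolutely_monotonic_binomial_transform:
  assumes "\<And>k. f k \<ge> 0"
  shows "absolutely_monotonic (binomial_transform f)"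
  unfolding absolutely_monotonic_def fwd_diff_funpow_binomial_transform
  by (simp add: binomial_transform_def assms sum_nonneg)

text \<open>Real scalars acting by \<open>smult\<close> agree with the ring's own
  \<open>of_nat\<close> coefficients.\<close>

lemma sum_smult_eq_binomial_transform:
  "(\<Sum>k=0..n. smult (real (n choose k)) (f k)) = binomial_transform f n"
  by (simp add: binomial_transform_def atMost_atLeast0 of_nat_poly)

lemma H_poly_eq_binomial_transform:
  "H_poly h = binomial_transform (\<lambda>j. monom 1 (h j))"
  by (simp add: fun_eq_iff H_poly_def sum_smult_eq_binomial_transform)

theorem proposition3p1:
  fixes h :: "nat \<Rightarrow> nat"
  assumes "eventually_increasing h"
  shows "(\<forall>r n. (\<Sum>k=0..r. smult ((-1) ^ k * real (r choose k)) (H_poly h (n + r - k)))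
              = (\<Sum>k=0..n. smult (real (n choose k)) (monom 1 (h (k + r)))))
       \<and> (\<forall>z::real. z > 0 \<longrightarrow> absolutely_monotonic (\<lambda>n. poly (H_poly h n) z))"
proof (intro conjI allI impI)
  fix r n
  have smult_eq: "smult ((-1) ^ k * real m) p = (-1) ^ k * of_nat m * p" for k m p
    by (cases "even k") (simp_all add: of_nat_poly)
  show "(\<Sum>k=0..r. smult ((-1) ^ k * real (r choose k)) (H_poly h (n + r - k)))
      = (\<Sum>k=0..n. smult (real (n choose k)) (monom 1 (h (k + r))))"
    unfolding smult_eq sum_smult_eq_binomial_transform H_poly_eq_binomial_transform
    by (simp add: alternating_sum_binomial_transform flip: atMost_atLeast0)
next
  fix z :: real
  assume "z > 0"
  \<comment> \<open>Evaluation at \<open>z\<close> commutes with the transform, leaving real terms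
    that are positive.\<close>
  moreover have "(\<lambda>n. poly (H_poly h n) z) = binomial_transform (\<lambda>j. z ^ h j)"
    by (simp add: fun_eq_iff H_poly_def binomial_transform_def poly_sum poly_monom
        atMost_atLeast0)
  ultimately show "absolutely_monotonic (\<lambda>n. poly (H_poly h n) z)"
    by (simp add: absolutely_monotonic_binomial_transform)
qed

end
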